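(* Suppose that $\kappa = \nu^+$, $J$ is a $\kappa$-complete ideal on $\kappa$ such that $\clubsuit_\kappa^{{\rm cof}, -}[J]$ holds, and $\tau$ is a regular cardinal less than $Depth({}^\kappa\kappa)$. Then there exists either an ascending $(J, I_\kappa)$-tower of length $\tau$, or a descending $(J, J)$-tower of length $\tau$.
   Context: An ideal on $\kappa$ is a nonempty $J \subseteq P(\kappa)$ with $\kappa \notin J$, every bounded subset of $\kappa$ in $J$, $J$ closed under subsets and under unions of two members; $J^+ = P(\kappa)\setminus J$; $\kappa$-complete means closed under unions of fewer than $\kappa$ members. $I_\kappa$ is the ideal of bounded subsets of $\kappa$. For a set $A$ and cardinal $\rho$, $P_\rho(A) = \{a \subseteq A : |a| < \rho\}$, and $[\kappa]^\kappa$ is the set of size-$\kappa$ subsets of $\kappa$. $\clubsuit_\kappa^{{\rm cof}, -}[J]$ asserts the existence of $B^i_\delta \in P_{|\delta|}(\delta)$ for $i < \delta < \kappa$ such that for any $W \in [\kappa]^\kappa$, $\{\delta < \kappa : \exists i < \delta\, (\sup(W \cap B^i_\delta) = \delta)\} \in J^+$. For $f, g \in {}^\kappa\kappa$, $f <^* g$ means $|\{\alpha < \kappa : f(\alpha) \geq g(\alpha)\}| < \kappa$; $Depth({}^\kappa\kappa)$ is the least ordinal $\eta$ such that there is no $<^*$-increasing sequence $\langle f_i : i < \eta\rangle$ in ${}^\kappa\kappa$. For $Y \subseteq P(\kappa)$ and an ordinal $\delta$, a descending (respectively, ascending) $(J,Y)$-tower of length $\delta$ is a sequence $\langle A_\alpha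 : \alpha < \delta\rangle$ with each $A_\alpha \in J^+$ such that whenever $\alpha < \beta < \delta$: $A_\beta \setminus A_\alpha \in Y$ and $A_\alpha \setminus A_\beta \in J^+$ (respectively, $A_\alpha \setminus A_\beta \in Y$ and $A_\beta \setminus A_\alpha \in J^+$). *)

theory Defs
  imports Main
begin

unbundle cardinal_syntax

text \<open>Cardinals/ordinals are represented as well-orders (HOL's BNF cardinal library).
  The cardinal kappa is a card order r; its ordinals are the elements of Field r,
  the ordinal delta viewed as a set is underS r delta.\<close>

definition lt_in :: "'a rel \<Rightarrow> 'a \<Rightarrow> 'a \<Rightarrow> bool" where
  "lt_in r x y \<longleftrightarrow> (x, y) \<in> r \<and> x \<noteq> y"

definition bounded_in :: "'a rel \<Rightarrow> 'a set \<Rightarrow> bool" where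
  "bounded_in r A \<longleftrightarrow> A \<subseteq> Field r \<and> (\<exists>\<beta>\<in>Field r. \<forall>x\<in>A. lt_in r x \<beta>)"

definition I_kappa :: "'a rel \<Rightarrow> 'a set set" where
  "I_kappa r = {A. bounded_in r A}"

definition is_ideal :: "'a rel \<Rightarrow> 'a set set \<Rightarrow> bool" where
  "is_ideal r J \<longleftrightarrow>
     J \<noteq> {} \<and> J \<subseteq> Pow (Field r) \<and> Field r \<notin> J \<and>
     (\<forall>A. bounded_in r A \<longrightarrow> A \<in> J) \<and>
     (\<forall>A B. A \<in> J \<and> B \<subseteq> A \<longrightarrow> B \<in> J) \<and>
     (\<forall>A B. A \<in> J \<and> B \<in> J \<longrightarrow> A \<union> B \<in> J)"

definition complete_ideal :: "'a rel \<Rightarrow> 'a set set \<Rightarrow> bool" where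
  "complete_ideal r J \<longleftrightarrow> is_ideal r J \<and>
     (\<forall>F. F \<subseteq> J \<and> |F| <o r \<longrightarrow> \<Union>F \<in> J)"

definition Jplus :: "'a rel \<Rightarrow> 'a set set \<Rightarrow> 'a set set" where
  "Jplus r J = Pow (Field r) - J"

definition sup_eq :: "'a rel \<Rightarrow> 'a set \<Rightarrow> 'a \<Rightarrow> bool" where
  "sup_eq r S \<delta> \<longleftrightarrow> S \<subseteq> underS r \<delta> \<and>
     (\<forall>\<gamma>\<in>underS r \<delta>. \<exists>x\<in>S. lt_in r \<gamma> x)"

definition clubsuit_cof_minus :: "'a rel \<Rightarrow> 'a set set \<Rightarrow> bool" where
  "clubsuit_cof_minus r J \<longleftrightarrow>
     (\<exists>B :: 'a \<Rightarrow> 'a \<Rightarrow> 'a set.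
        (\<forall>\<delta>\<in>Field r. \<forall>i\<in>underS r \<delta>.
            B \<delta> i \<subseteq> underS r \<delta> \<and> card_of (B \<delta> i) <o card_of (underS r \<delta>)) \<and>
        (\<forall>W. W \<subseteq> Field r \<and> card_of W =o r \<longrightarrow>
            {\<delta>\<in>Field r. \<exists>i\<in>underS r \<delta>. sup_eq r (W \<inter> B \<delta> i) \<delta>} \<in> Jplus r J))"

definition fun_kk :: "'a rel \<Rightarrow> ('a \<Rightarrow> 'a) \<Rightarrow> bool" where
  "fun_kk r f \<longleftrightarrow> (\<forall>x\<in>Field r. f x \<in> Field r)"

definition lt_star :: "'a rel \<Rightarrow> ('a \<Rightarrow> 'a) \<Rightarrow> ('a \<Rightarrow> 'a) \<Rightarrow> bool" where
  "lt_star r f g \<longleftrightarrow> |{\<alpha>\<in>Field r. (g \<alpha>, f \<alpha>) \<in> r}| <o r"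

definition incr_seq :: "'a rel \<Rightarrow> 'c rel \<Rightarrow> ('c \<Rightarrow> 'a \<Rightarrow> 'a) \<Rightarrow> bool" where
  "incr_seq r \<eta> f \<longleftrightarrow> (\<forall>i\<in>Field \<eta>. fun_kk r (f i)) \<and>
     (\<forall>i j. lt_in \<eta> i j \<longrightarrow> lt_star r (f i) (f j))"

text \<open>tau < Depth(^kappa kappa): since Depth is the least ordinal eta with no increasing
  sequence of length eta, tau < Depth iff every ordinal eta \<le> tau carries one.\<close>
definition below_depth :: "'a rel \<Rightarrow> 'c rel \<Rightarrow> bool" where
  "below_depth r \<tau> \<longleftrightarrow>
     (\<forall>\<eta> :: 'c rel. Well_order \<eta> \<and> \<eta> \<le>o \<tau> \<longrightarrow> (\<exists>f. incr_seq r \<eta> f))"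

definition desc_tower :: "'a rel \<Rightarrow> 'a set set \<Rightarrow> 'a set set \<Rightarrow> 'c rel \<Rightarrow> ('c \<Rightarrow> 'a set) \<Rightarrow> bool" where
  "desc_tower r J Y \<delta> A \<longleftrightarrow> (\<forall>\<alpha>\<in>Field \<delta>. A \<alpha> \<in> Jplus r J) \<and>
     (\<forall>\<alpha> \<beta>. lt_in \<delta> \<alpha> \<beta> \<longrightarrow> A \<beta> - A \<alpha> \<in> Y \<and> A \<alpha> - A \<beta> \<in> Jplus r J)"

definition asc_tower :: "'a rel \<Rightarrow> 'a set set \<Rightarrow> 'a set set \<Rightarrow> 'c rel \<Rightarrow> ('c \<Rightarrow> 'a set) \<Rightarrow> bool" where
  "asc_tower r J Y \<delta> A \<longleftrightarrow> (\<forall>\<alpha>\<in>Field \<delta>. A \<alpha> \<in> Jplus r J) \<and>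
     (\<forall>\<alpha> \<beta>. lt_in \<delta> \<alpha> \<beta> \<longrightarrow> A \<alpha> - A \<beta> \<in> Y \<and> A \<beta> - A \<alpha> \<in> Jplus r J)"

end

theory Submission
  imports Defs
begin

text \<open>
  Code pairs of ordinals below \<open>\<kappa>\<close> by ordinals below \<open>\<kappa>\<close>. For an increasing sequence \<open>f\<close> of
  length \<open>\<tau> > \<nu>\<close>, let \<open>W a b\<close> be the set of codes of pairs \<open>(\<xi>, \<eta>)\<close> with
  \<open>f a \<xi> \<le> \<eta> < f b \<xi>\<close>; modulo bounded sets it grows with \<open>b\<close> and shrinks with \<open>a\<close>, and gaps over
  disjoint intervals are disjoint. Index the guessing sets by \<open>i < \<nu>\<close> and let \<open>M i a b\<close> be the set
  of \<open>\<delta>\<close> at which the \<open>i\<close>-th guess meets \<open>W a b\<close> cofinally. If there is no ascending tower,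
  \<open>M i a b\<close> stabilises modulo \<open>J\<close> in \<open>b\<close>, with limit \<open>N i a\<close>; if there is no descending tower,
  \<open>N i a\<close> stabilises in \<open>a\<close>. Take \<open>\<nu>\<close> many successive gaps beyond the points of stabilisation: if
  some \<open>N i a\<close> were positive, a single guess of size less than \<open>\<nu>\<close> would meet \<open>\<nu>\<close> many disjoint
  sets. So all \<open>N i a\<close>, and hence all \<open>M i a b\<close>, are in \<open>J\<close>, which contradicts guessing by
  \<open>\<kappa>\<close>-completeness. If \<open>\<tau> \<le> \<nu>\<close>, apply this to the constant functions, a sequence of length \<open>\<kappa>\<close>,
  and restrict the resulting tower.
\<close>

section \<open>Strict order in well-orders\<close>

lemma lt_in_Field: "lt_in r x y \<Longrightarrow> x \<in> Field r \<and> y \<in> Field r"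
  by (auto simp: lt_in_def Field_def)

lemma lt_in_iff_underS: "lt_in r x y \<longleftrightarrow> x \<in> underS r y"
  by (auto simp: lt_in_def underS_def)

lemma lt_in_trans: "Well_order r \<Longrightarrow> lt_in r x y \<Longrightarrow> lt_in r y z \<Longrightarrow> lt_in r x z"
  unfolding lt_in_def well_order_on_def linear_order_on_def partial_order_on_def preorder_on_def
  by (metis antisymD transD)

lemma le_lt_in_trans: "Well_order r \<Longrightarrow> (x, y) \<in> r \<Longrightarrow> lt_in r y z \<Longrightarrow> lt_in r x z"
  unfolding lt_in_def well_order_on_def linear_order_on_def partial_order_on_def preorder_on_def
  by (metis antisymD transD)

lemma lt_le_in_trans: "Well_order r \<Longrightarrow> lt_in r x y \<Longrightarrow> (y, z) \<in> r \<Longrightarrow> lt_in r x z"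
  unfolding lt_in_def well_order_on_def linear_order_on_def partial_order_on_def preorder_on_def
  by (metis antisymD transD)

lemma Well_order_refl: "Well_order r \<Longrightarrow> x \<in> Field r \<Longrightarrow> (x, x) \<in> r"
  unfolding well_order_on_def linear_order_on_def partial_order_on_def preorder_on_def
  by (metis refl_onD)

lemma not_le_iff_lt_in:
  "Well_order r \<Longrightarrow> x \<in> Field r \<Longrightarrow> y \<in> Field r \<Longrightarrow> (x, y) \<notin> r \<longleftrightarrow> lt_in r y x"
  unfolding lt_in_def well_order_on_def linear_order_on_def partial_order_on_def preorder_on_def
    total_on_def
  by (metis antisymD refl_onD)

lemma lt_in_total:
  "Well_order r \<Longrightarrow> x \<in> Field r \<Longrightarrow> y \<in> Field r \<Longrightarrow> x \<noteq> y \<Longrightarrow> lt_in r x y \<or> lt_in r y x"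
  using not_le_iff_lt_in[of r x y] by (auto simp: lt_in_def)

lemma lt_in_max:
  assumes "Well_order r" "lt_in r x z" "lt_in r y z"
  obtains m where "(x, m) \<in> r" "(y, m) \<in> r" "lt_in r m z"
  by (metis assms lt_in_Field lt_in_def not_le_iff_lt_in Well_order_refl)

lemma ex_lt_in_greater:
  assumes "Card_order r" "\<not> finite (Field r)" "x \<in> Field r"
  obtains y where "lt_in r x y"
  using infinite_Card_order_limit[OF assms] by (auto simp: lt_in_def)

lemma lt_in_common:
  assumes "Card_order r" "\<not> finite (Field r)" "x \<in> Field r" "y \<in> Field r"
  obtains z where "lt_in r x z" "lt_in r y z"
proof -
  have wo: "Well_order r" using assms(1) card_order_on_well_order_on by blast
  obtain x' y' where "lt_in r x x'" "lt_in r y y'"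
    using ex_lt_in_greater[OF assms(1,2)] assms(3,4) by metis
  then show ?thesis
    using that lt_in_trans[OF wo] not_le_iff_lt_in[OF wo, of x y] lt_le_in_trans[OF wo]
      le_lt_in_trans[OF wo] assms(3,4) by blast
qed

section \<open>Regular cardinals: bounds, recursive choices, towers or stabilisation\<close>

lemma regularCard_strict_bound:
  assumes r: "Card_order r" "\<not> finite (Field r)" "regularCard r"
    and S: "S \<subseteq> Field r" "|S| <o r"
  obtains y where "y \<in> Field r" "\<And>x. x \<in> S \<Longrightarrow> lt_in r x y"
proof -
  have "\<not> cofinal S r"
    using r(3) S not_ordLess_ordIso unfolding regularCard_def by blast
  then obtain a where a: "a \<in> Field r" "\<forall>b\<in>S. a = b \<or> (a, b) \<notin> r"
    by (auto simp: cofinal_def)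
  \<comment> \<open>\<open>cofinal\<close> asks for strictly larger elements, so its failure puts
    \<open>S\<close> only weakly below \<open>a\<close>; one step further up makes the bound
    strict.\<close>
  obtain y where y: "lt_in r a y" using ex_lt_in_greater[OF r(1,2) a(1)] .
  have wo: "Well_order r" using r(1) card_order_on_well_order_on by blast
  show ?thesis
  proof (rule that)
    show "y \<in> Field r" using lt_in_Field[OF y] by simp
    fix x assume x: "x \<in> S"
    have "(x, a) \<in> r"
    proof (cases "x = a")
      case True
      then show ?thesis using Well_order_refl[OF wo a(1)] by simp
    next
      case False
      then have "(a, x) \<notin> r" "x \<in> Field r" using a x S(1) by auto
      then show ?thesis using not_le_iff_lt_in[OF wo a(1)] by (simp add: lt_in_def)
    qed
    then show "lt_in r x y" using le_lt_in_trans[OF wo _ y] by blast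
  qed
qed

text \<open>Recursion along \<open>\<sigma>\<close>: fewer than \<tau> values precede stage
  \<open>j\<close>, so regularity leaves room above \<open>b\<close> and above every earlier
  \<open>c (g i)\<close>. The case \<open>\<sigma> = \<tau>\<close> serves to build towers, the case
  \<open>\<sigma> = \<nu>\<close> to choose disjoint gaps.\<close>

lemma increasing_selection:
  assumes t: "Card_order \<tau>" "\<not> finite (Field \<tau>)" "regularCard \<tau>"
    and s: "Well_order \<sigma>" "\<And>j. j \<in> Field \<sigma> \<Longrightarrow> |underS \<sigma> j| <o \<tau>"
    and c: "\<And>x. x \<in> Field \<tau> \<Longrightarrow> c x \<in> Field \<tau>"
    and b: "b \<in> Field \<tau>"
  obtains g where "\<And>j. j \<in> Field \<sigma> \<Longrightarrow> lt_in \<tau> b (g j)"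
    and "\<And>i j. lt_in \<sigma> i j \<Longrightarrow> lt_in \<tau> (c (g i)) (g j)"
proof -
  let ?P = "\<lambda>f j y. j \<in> Field \<sigma> \<longrightarrow> lt_in \<tau> b y \<and> (\<forall>i\<in>underS \<sigma> j. lt_in \<tau> (c (f i)) y)"
  have wf: "wf (\<sigma> - Id)"
    using s(1) by (simp add: well_order_on_def)
  have lt: "(i, j) \<in> \<sigma> - Id \<longleftrightarrow> i \<in> underS \<sigma> j" for i j
    by (auto simp: underS_def)
  have wo: "Well_order \<tau>" using t(1) card_order_on_well_order_on by blast
  have "\<exists>f. \<forall>j. ?P f j (f j)"
  proof (rule dependent_wf_choice[OF wf])
    fix f g :: "'b \<Rightarrow> 'a" and j y
    assume "\<And>i. (i, j) \<in> \<sigma> - Id \<Longrightarrow> f i = g i"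
    then show "?P f j y = ?P g j y" unfolding lt by auto
  next
    fix j and f :: "'b \<Rightarrow> 'a"
    assume IH: "\<And>i. (i, j) \<in> \<sigma> - Id \<Longrightarrow> ?P f i (f i)"
    show "\<exists>y. ?P f j y"
    proof (cases "j \<in> Field \<sigma>")
      case True
      let ?S = "(\<lambda>i. c (f i)) ` underS \<sigma> j"
      have "f i \<in> Field \<tau>" if "i \<in> underS \<sigma> j" for i
        using IH[of i] that lt lt_in_Field[of \<tau> b "f i"] underS_Field[of i \<sigma> j] by blast
      then have "?S \<subseteq> Field \<tau>" using c by blast
      moreover have "|?S| <o \<tau>"
        using card_of_image s(2)[OF True] ordLeq_ordLess_trans by blast
      ultimately obtain y where y: "y \<in> Field \<tau>" "\<And>x. x \<in> ?S \<Longrightarrow> lt_in \<tau> x y"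
        using regularCard_strict_bound[OF t] by blast
      obtain z where "lt_in \<tau> b z" "lt_in \<tau> y z" using lt_in_common[OF t(1,2) b y(1)] .
      then have "?P f j z" using y(2) lt_in_trans[OF wo] by blast
      then show ?thesis by blast
    qed simp
  qed
  then obtain f where f: "\<And>j. ?P f j (f j)" by blast
  show ?thesis
  proof (rule that)
    show "lt_in \<tau> b (f j)" if "j \<in> Field \<sigma>" for j using f[of j] that by blast
    show "lt_in \<tau> (c (f i)) (f j)" if "lt_in \<sigma> i j" for i j
      using f[of j] that lt_in_Field[OF that] by (simp add: lt_in_iff_underS)
  qed
qed

text \<open>If no point is stable, each \<open>x\<close> beyond \<open>a\<close> has a later
  \<open>c x\<close> at which \<open>A\<close> has gained a positive set, and iterating
  \<open>c\<close> along \<tau> yields a tower. Everything happens beyond \<open>a\<close> because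
  the intended \<open>A x\<close> is derived from a gap that starts at \<open>a\<close>.\<close>

lemma asc_tower_or_stable:
  assumes t: "Card_order \<tau>" "\<not> finite (Field \<tau>)" "regularCard \<tau>"
    and J: "is_ideal r J" and a: "a \<in> Field \<tau>"
    and A: "\<And>x. A x \<subseteq> Field r"
    and mono: "\<And>x y. lt_in \<tau> a x \<Longrightarrow> lt_in \<tau> x y \<Longrightarrow> A x - A y \<in> I_kappa r"
    and none: "\<nexists>T. asc_tower r J (I_kappa r) \<tau> T"
  shows "\<exists>x. lt_in \<tau> a x \<and> (\<forall>y. lt_in \<tau> x y \<longrightarrow> A y - A x \<in> J)"
proof (rule ccontr)
  assume "\<not> ?thesis"
  then obtain c where c: "\<And>x. lt_in \<tau> a x \<Longrightarrow> lt_in \<tau> x (c x) \<and> A (c x) - A x \<notin> J"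
    by metis
  \<comment> \<open>The default \<open>a\<close> only keeps values inside
    \<open>Field \<tau>\<close>; the selected points lie beyond \<open>a\<close>, where
    \<open>c'\<close> agrees with \<open>c\<close>.\<close>
  define c' where "c' x = (if lt_in \<tau> a x then c x else a)" for x
  have wo: "Well_order \<tau>" using t(1) card_order_on_well_order_on by blast
  have J': "\<And>X Y. X \<in> J \<Longrightarrow> Y \<subseteq> X \<Longrightarrow> Y \<in> J" "\<And>X Y. X \<in> J \<Longrightarrow> Y \<in> J \<Longrightarrow> X \<union> Y \<in> J"
    "I_kappa r \<subseteq> J"
    using J unfolding is_ideal_def I_kappa_def by blast+
  have u: "|underS \<tau> j| <o \<tau>" if "j \<in> Field \<tau>" for j
    using card_of_underS[OF t(1) that] .
  have d: "c' x \<in> Field \<tau>" if "x \<in> Field \<tau>" for x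
    using c a lt_in_Field[of \<tau> x "c x"] by (auto simp: c'_def)
  obtain g where g: "\<And>j. j \<in> Field \<tau> \<Longrightarrow> lt_in \<tau> a (g j)"
    "\<And>i j. lt_in \<tau> i j \<Longrightarrow> lt_in \<tau> (c' (g i)) (g j)"
    using increasing_selection[where c = c', OF t wo u d a] by blast
  have cg: "lt_in \<tau> (g j) (c (g j))" "A (c (g j)) - A (g j) \<notin> J" if "j \<in> Field \<tau>" for j
    using c g(1)[OF that] by blast+
  have ag: "lt_in \<tau> a (c (g j))" if "j \<in> Field \<tau>" for j
    using lt_in_trans[OF wo g(1) cg(1)] that by blast
  \<comment> \<open>The terms sit at \<open>c (g j)\<close>, not at \<open>g j\<close>: the gain
    over \<open>A (g j)\<close> makes even the first term positive, and it is new relative to all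
    earlier terms, which lie in \<open>A (g j)\<close> modulo bounded sets.\<close>
  have "asc_tower r J (I_kappa r) \<tau> (\<lambda>j. A (c (g j)))"
    unfolding asc_tower_def
  proof (intro conjI ballI allI impI)
    show "A (c (g j)) \<in> Jplus r J" if "j \<in> Field \<tau>" for j
      using cg(2)[OF that] A J'(1) unfolding Jplus_def by blast
    fix i j assume ij: "lt_in \<tau> i j"
    then have F: "i \<in> Field \<tau>" "j \<in> Field \<tau>" using lt_in_Field by fast+
    have i_j: "lt_in \<tau> (c (g i)) (g j)" using g(2)[OF ij] g(1)[OF F(1)] by (simp add: c'_def)
    show "A (c (g i)) - A (c (g j)) \<in> I_kappa r"
      using mono ag[OF F(1)] lt_in_trans[OF wo i_j cg(1)[OF F(2)]] by blast
    have "A (c (g i)) - A (g j) \<in> J" using mono ag[OF F(1)] i_j J'(3) by blast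
    moreover have "A (c (g j)) - A (g j) \<subseteq> (A (c (g j)) - A (c (g i))) \<union> (A (c (g i)) - A (g j))"
      by blast
    ultimately have "A (c (g j)) - A (c (g i)) \<notin> J" using cg(2)[OF F(2)] J'(1,2) by blast
    then show "A (c (g j)) - A (c (g i)) \<in> Jplus r J" using A unfolding Jplus_def by blast
  qed
  then show False using none by blast
qed

text \<open>Dual argument: at an unstable \<open>x\<close> a positive set is lost on the way to
  \<open>c x\<close>. Inclusion is taken modulo \<open>J\<close> because the lemma is meant for
  limits that are themselves determined only modulo \<open>J\<close>.\<close>

lemma desc_tower_or_stable:
  assumes t: "Card_order \<tau>" "\<not> finite (Field \<tau>)" "regularCard \<tau>"
    and J: "is_ideal r J"
    and A: "\<And>x. A x \<subseteq> Field r"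
    and mono: "\<And>x y. lt_in \<tau> x y \<Longrightarrow> A y - A x \<in> J"
    and none: "\<nexists>T. desc_tower r J J \<tau> T"
  shows "\<exists>x\<in>Field \<tau>. \<forall>y. lt_in \<tau> x y \<longrightarrow> A x - A y \<in> J"
proof (rule ccontr)
  assume "\<not> ?thesis"
  then obtain c where c: "\<And>x. x \<in> Field \<tau> \<Longrightarrow> lt_in \<tau> x (c x) \<and> A x - A (c x) \<notin> J"
    by metis
  have wo: "Well_order \<tau>" using t(1) card_order_on_well_order_on by blast
  have J': "\<And>X Y. X \<in> J \<Longrightarrow> Y \<subseteq> X \<Longrightarrow> Y \<in> J" "\<And>X Y. X \<in> J \<Longrightarrow> Y \<in> J \<Longrightarrow> X \<union> Y \<in> J"
    using J unfolding is_ideal_def by blast+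
  have "Field \<tau> \<noteq> {}" using t(2) by auto
  then obtain a where a: "a \<in> Field \<tau>" by blast
  have u: "|underS \<tau> j| <o \<tau>" if "j \<in> Field \<tau>" for j
    using card_of_underS[OF t(1) that] .
  have d: "c x \<in> Field \<tau>" if "x \<in> Field \<tau>" for x
    using c[OF that] lt_in_Field[of \<tau> x "c x"] by blast
  obtain g where g: "\<And>j. j \<in> Field \<tau> \<Longrightarrow> lt_in \<tau> a (g j)"
    "\<And>i j. lt_in \<tau> i j \<Longrightarrow> lt_in \<tau> (c (g i)) (g j)"
    using increasing_selection[where c = c, OF t wo u d a] by blast
  have cg: "lt_in \<tau> (g j) (c (g j))" "A (g j) - A (c (g j)) \<notin> J" if "j \<in> Field \<tau>" for j
    using c g(1)[OF that] lt_in_Field[of \<tau> a "g j"] by blast+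
  \<comment> \<open>Now \<open>g j\<close> itself is the right place: \<open>A (g j)\<close>
    contains the positive set that is lost by \<open>c (g j)\<close>.\<close>
  have "desc_tower r J J \<tau> (\<lambda>j. A (g j))"
    unfolding desc_tower_def
  proof (intro conjI ballI allI impI)
    show "A (g j) \<in> Jplus r J" if "j \<in> Field \<tau>" for j
      using cg(2)[OF that] A J'(1) unfolding Jplus_def by blast
    fix i j assume ij: "lt_in \<tau> i j"
    then have F: "i \<in> Field \<tau>" "j \<in> Field \<tau>" using lt_in_Field by fast+
    show "A (g j) - A (g i) \<in> J"
      using mono lt_in_trans[OF wo cg(1)[OF F(1)] g(2)[OF ij]] by blast
    have "A (g j) - A (c (g i)) \<in> J" using mono g(2)[OF ij] by blast
    moreover have "A (g i) - A (c (g i)) \<subseteq> (A (g i) - A (g j)) \<union> (A (g j) - A (c (g i)))"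
      by blast
    ultimately have "A (g i) - A (g j) \<notin> J" using cg(2)[OF F(1)] J'(1,2) by blast
    then show "A (g i) - A (g j) \<in> Jplus r J" using A unfolding Jplus_def by blast
  qed
  then show False using none by blast
qed

lemma lt_in_embed:
  assumes "Well_order \<sigma>" "embed \<sigma> r e" "lt_in \<sigma> x y"
  shows "lt_in r (e x) (e y)"
  using embed_underS[OF assms(1,2), of y] lt_in_Field[OF assms(3)] assms(3)
  by (auto simp: lt_in_iff_underS bij_betw_def)

text \<open>The tower conditions concern single terms and pairs in strict order, so they pull back
  along an embedding.\<close>

lemma tower_restrict:
  assumes "Well_order \<sigma>" "embed \<sigma> \<tau> e"
  shows "asc_tower r J Y \<tau> A \<Longrightarrow> asc_tower r J Y \<sigma> (A \<circ> e)"
    and "desc_tower r J Y \<tau> A \<Longrightarrow> desc_tower r J Y \<sigma> (A \<circ> e)"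
  using lt_in_embed[OF assms] embed_in_Field[OF assms(2)]
  by (simp_all add: asc_tower_def desc_tower_def)

text \<open>The guessing principle with an index set \<nu> that does not depend on \<delta>. A fixed
  index \<open>i\<close> can then be followed through all \<delta>, and the guessing set is a union
  of \<nu> many pieces, to which \<kappa>-completeness applies.\<close>

locale cof_guessing =
  fixes r :: "'a rel" and \<nu> :: "'b rel" and J :: "'a set set" and B :: "'a \<Rightarrow> 'b \<Rightarrow> 'a set"
  assumes card_r: "Card_order r" and card_nu: "Card_order \<nu>" and succ: "r =o cardSuc \<nu>"
    and inf_nu: "\<not> finite (Field \<nu>)"
    and ideal: "complete_ideal r J"
    and B_small: "\<And>\<delta> i. \<delta> \<in> Field r \<Longrightarrow> i \<in> Field \<nu> \<Longrightarrow> |B \<delta> i| <o \<nu>"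
    and B_below: "\<And>\<delta> i. \<delta> \<in> Field r \<Longrightarrow> i \<in> Field \<nu> \<Longrightarrow> B \<delta> i \<subseteq> underS r \<delta>"
    and B_guess: "\<And>W. W \<subseteq> Field r \<Longrightarrow> |W| =o r \<Longrightarrow>
      (\<Union>i\<in>Field \<nu>. {\<delta>\<in>Field r. sup_eq r (W \<inter> B \<delta> i) \<delta>}) \<notin> J"
begin

definition guessed :: "'a set \<Rightarrow> 'b \<Rightarrow> 'a set" where
  "guessed W i = {\<delta>\<in>Field r. sup_eq r (W \<inter> B \<delta> i) \<delta>}"

section \<open>Sets of size at most \<nu> and the ideal\<close>

lemma well_r: "Well_order r"
  using card_r card_order_on_well_order_on by blast

lemma well_nu: "Well_order \<nu>"
  using card_nu card_order_on_well_order_on by blast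

lemma inf_r: "\<not> finite (Field r)"
proof -
  have "|Field r| =o |Field (cardSuc \<nu>)|" using card_of_cong[OF succ] .
  then show ?thesis
    using inf_nu cardSuc_finite[OF card_nu] card_of_ordIso_finite by blast
qed

lemma nu_less_r: "\<nu> <o r"
  using cardSuc_greater[OF card_nu] ordIso_symmetric[OF succ] ordLess_ordIso_trans by blast

lemma regular_r: "regularCard r"
proof -
  have "Cinfinite \<nu>" using inf_nu card_nu by (simp add: cinfinite_def)
  then show ?thesis
    using regularCard_ordIso[OF ordIso_symmetric[OF succ]] regularCard_cardSuc Cinfinite_cardSuc
    by blast
qed

lemma less_r_iff: "|X| <o r \<longleftrightarrow> |X| \<le>o \<nu>"
proof -
  have "|X| <o r \<longleftrightarrow> |X| <o cardSuc \<nu>"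
    using ordLess_ordIso_trans[OF _ succ] ordLess_ordIso_trans[OF _ ordIso_symmetric[OF succ]]
    by blast
  then show ?thesis using cardSuc_ordLeq_ordLess[OF card_nu card_of_Card_order] by blast
qed

lemma small_Un: "|X| \<le>o \<nu> \<Longrightarrow> |Y| \<le>o \<nu> \<Longrightarrow> |X \<union> Y| \<le>o \<nu>"
  using card_of_Un_ordLeq_infinite_Field[OF inf_nu] card_nu by blast

lemma small_UN: "(\<And>i. i \<in> Field \<nu> \<Longrightarrow> |F i| \<le>o \<nu>) \<Longrightarrow> |\<Union>i\<in>Field \<nu>. F i| \<le>o \<nu>"
  using card_of_UNION_ordLeq_infinite_Field[OF inf_nu card_nu]
    card_of_Field_ordIso[OF card_nu] ordIso_iff_ordLeq by blast

lemma small_subset: "|Y| \<le>o \<nu> \<Longrightarrow> X \<subseteq> Y \<Longrightarrow> |X| \<le>o \<nu>"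
  using card_of_mono1 ordLeq_transitive by blast

lemma small_bound:
  assumes "X \<subseteq> Field r" "|X| \<le>o \<nu>"
  obtains \<rho> where "\<rho> \<in> Field r" "\<And>x. x \<in> X \<Longrightarrow> lt_in r x \<rho>"
  using regularCard_strict_bound[OF card_r inf_r regular_r assms(1)] assms(2) less_r_iff by blast

lemma is_ideal: "is_ideal r J"
  using ideal by (simp add: complete_ideal_def)

lemma J_subset: "X \<in> J \<Longrightarrow> Y \<subseteq> X \<Longrightarrow> Y \<in> J"
  and J_Un: "X \<in> J \<Longrightarrow> Y \<in> J \<Longrightarrow> X \<union> Y \<in> J"
  and I_kappa_subset_J: "X \<in> I_kappa r \<Longrightarrow> X \<in> J"
  using is_ideal unfolding is_ideal_def I_kappa_def by blast+

lemma J_UN: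
  assumes "\<And>i. i \<in> Field \<nu> \<Longrightarrow> F i \<in> J"
  shows "(\<Union>i\<in>Field \<nu>. F i) \<in> J"
proof -
  have "|F ` Field \<nu>| \<le>o \<nu>"
    using card_of_image card_of_Field_ordIso[OF card_nu] ordLeq_ordIso_trans by blast
  moreover have "F ` Field \<nu> \<subseteq> J" using assms by blast
  ultimately show ?thesis using ideal less_r_iff unfolding complete_ideal_def by blast
qed

lemma J_Diff_trans: "X - Y \<in> J \<Longrightarrow> Y - Z \<in> J \<Longrightarrow> X - Z \<in> J"
  using J_subset[OF J_Un, of "X - Y" "Y - Z" "X - Z"] by blast

section \<open>Guessed sets and their stabilisation\<close>

lemma guessed_Field: "guessed W i \<subseteq> Field r"
  by (auto simp: guessed_def)

lemma under_bounded: "\<rho> \<in> Field r \<Longrightarrow> {\<delta>. (\<delta>, \<rho>) \<in> r} \<in> I_kappa r"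
proof -
  assume \<rho>: "\<rho> \<in> Field r"
  obtain \<rho>' where "lt_in r \<rho> \<rho>'" using ex_lt_in_greater[OF card_r inf_r \<rho>] .
  then show ?thesis
    using le_lt_in_trans[OF well_r] lt_in_Field[of r \<rho> \<rho>']
    unfolding I_kappa_def bounded_in_def by (auto simp: Field_def)
qed

text \<open>By regularity of \<kappa>, \<open>W - V\<close> has a bound \<rho>. If \<delta> is above
  \<rho>, the points of \<open>W \<inter> B \<delta> i\<close> above \<rho> all belong to
  \<open>V\<close>, so cofinality passes from \<open>W\<close> to \<open>V\<close>.\<close>

lemma guessed_mono:
  assumes i: "i \<in> Field \<nu>" and W: "W \<subseteq> Field r" and small: "|W - V| \<le>o \<nu>"
  shows "guessed W i - guessed V i \<in> I_kappa r"
proof -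
  obtain \<rho> where \<rho>: "\<rho> \<in> Field r" "\<And>x. x \<in> W - V \<Longrightarrow> lt_in r x \<rho>"
    using small_bound[OF _ small] W by blast
  have "(\<delta>, \<rho>) \<in> r" if d: "\<delta> \<in> guessed W i - guessed V i" for \<delta>
  proof (rule ccontr)
    assume "(\<delta>, \<rho>) \<notin> r"
    then have lt: "lt_in r \<rho> \<delta>" using not_le_iff_lt_in[OF well_r _ \<rho>(1)] d guessed_Field by blast
    have sup: "sup_eq r (W \<inter> B \<delta> i) \<delta>" using d by (simp add: guessed_def)
    have above: "\<exists>x\<in>V \<inter> B \<delta> i. lt_in r \<gamma> x" if "lt_in r \<gamma> \<delta>" for \<gamma>
    proof -
      have \<gamma>: "lt_in r \<gamma> \<delta>" using that .
      obtain m where m: "(\<gamma>, m) \<in> r" "(\<rho>, m) \<in> r" "lt_in r m \<delta>"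
        using lt_in_max[OF well_r \<gamma> lt] by blast
      obtain x where x: "x \<in> W \<inter> B \<delta> i" "lt_in r m x" "x \<in> underS r \<delta>"
        using sup m(3) unfolding sup_eq_def lt_in_iff_underS by blast
      have "lt_in r \<rho> x" using le_lt_in_trans[OF well_r m(2) x(2)] .
      then have "\<not> lt_in r x \<rho>" using lt_in_trans[OF well_r] lt_in_def by metis
      then show ?thesis using x \<rho>(2) le_lt_in_trans[OF well_r m(1) x(2)] by blast
    qed
    have "\<delta> \<in> Field r" using d guessed_Field by blast
    then have "sup_eq r (V \<inter> B \<delta> i) \<delta>"
      using above B_below i unfolding sup_eq_def lt_in_iff_underS by blast
    then show False using d \<open>\<delta> \<in> Field r\<close> by (simp add: guessed_def)
  qed
  then have "guessed W i - guessed V i \<subseteq> {\<delta>. (\<delta>, \<rho>) \<in> r}" by blast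
  then show ?thesis
    using under_bounded[OF \<rho>(1)] unfolding I_kappa_def bounded_in_def by blast
qed

text \<open>The gaps are abstract here: they are monotone at both ends and disjoint over separated
  intervals, up to sets of size at most \<nu>. Since \<nu> is below the regular \<tau>,
  stabilisation points for all indices have a common bound.\<close>

lemma tower_of_gaps:
  fixes \<tau> :: "'c rel" and W :: "'c \<Rightarrow> 'c \<Rightarrow> 'a set"
  assumes t: "Card_order \<tau>" "\<not> finite (Field \<tau>)" "regularCard \<tau>" and nu_t: "\<nu> <o \<tau>"
    and W_Field: "\<And>a b. W a b \<subseteq> Field r"
    and W_card: "\<And>a b. lt_in \<tau> a b \<Longrightarrow> |W a b| =o r"
    and W_upper: "\<And>a b c. lt_in \<tau> a b \<Longrightarrow> lt_in \<tau> b c \<Longrightarrow> |W a b - W a c| \<le>o \<nu>"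
    and W_lower: "\<And>a b c. lt_in \<tau> a b \<Longrightarrow> lt_in \<tau> b c \<Longrightarrow> |W b c - W a c| \<le>o \<nu>"
    and W_disj: "\<And>a b c d. lt_in \<tau> a b \<Longrightarrow> lt_in \<tau> b c \<Longrightarrow> lt_in \<tau> c d \<Longrightarrow> |W a b \<inter> W c d| \<le>o \<nu>"
  shows "(\<exists>A. asc_tower r J (I_kappa r) \<tau> A) \<or> (\<exists>A. desc_tower r J J \<tau> A)"
proof (rule ccontr)
  assume "\<not> ?thesis"
  then have no_asc: "\<nexists>A. asc_tower r J (I_kappa r) \<tau> A" and no_desc: "\<nexists>A. desc_tower r J J \<tau> A"
    by blast+
  have wo: "Well_order \<tau>" using t(1) card_order_on_well_order_on by blast
  note tr = lt_in_trans[OF wo]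
  have bound: "\<exists>y\<in>Field \<tau>. \<forall>i\<in>Field \<nu>. lt_in \<tau> (F i) y" if F: "\<And>i. i \<in> Field \<nu> \<Longrightarrow> F i \<in> Field \<tau>" for F
  proof -
    have "|F ` Field \<nu>| <o \<tau>"
      using card_of_image card_of_Field_ordIso[OF card_nu] nu_t
      by (metis ordIso_iff_ordLeq ordLeq_ordLess_trans ordLeq_transitive)
    moreover have "F ` Field \<nu> \<subseteq> Field \<tau>" using F by blast
    ultimately obtain y where "y \<in> Field \<tau>" "\<And>x. x \<in> F ` Field \<nu> \<Longrightarrow> lt_in \<tau> x y"
      using regularCard_strict_bound[OF t] by blast
    then show ?thesis by blast
  qed

  have upper: "guessed (W a b) i - guessed (W a c) i \<in> I_kappa r"
    if "i \<in> Field \<nu>" "lt_in \<tau> a b" "lt_in \<tau> b c" for i a b c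
    using guessed_mono[OF that(1) W_Field W_upper[OF that(2,3)]] .
  have lower: "guessed (W b c) i - guessed (W a c) i \<in> I_kappa r"
    if "i \<in> Field \<nu>" "lt_in \<tau> a b" "lt_in \<tau> b c" for i a b c
    using guessed_mono[OF that(1) W_Field W_lower[OF that(2,3)]] .

  have "\<exists>x. lt_in \<tau> a x \<and> (\<forall>y. lt_in \<tau> x y \<longrightarrow> guessed (W a y) i - guessed (W a x) i \<in> J)"
    if "i \<in> Field \<nu>" "a \<in> Field \<tau>" for i a
    using asc_tower_or_stable[where A = "\<lambda>x. guessed (W a x) i", OF t is_ideal that(2)
        guessed_Field _ no_asc] upper[OF that(1)] by blast
  then obtain s where s: "\<And>i a. i \<in> Field \<nu> \<Longrightarrow> a \<in> Field \<tau> \<Longrightarrow> lt_in \<tau> a (s i a)"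
    "\<And>i a y. i \<in> Field \<nu> \<Longrightarrow> a \<in> Field \<tau> \<Longrightarrow> lt_in \<tau> (s i a) y \<Longrightarrow>
      guessed (W a y) i - guessed (W a (s i a)) i \<in> J"
    by metis
  \<comment> \<open>The limit is represented by its value at one point of stabilisation; any later
    value agrees with it modulo \<open>J\<close>.\<close>
  define N where "N i a = guessed (W a (s i a)) i" for i a
  have N_mono: "N i b - N i a \<in> J" if i: "i \<in> Field \<nu>" and ab: "lt_in \<tau> a b" for i a b
  proof -
    have F: "a \<in> Field \<tau>" "b \<in> Field \<tau>" using lt_in_Field[OF ab] by auto
    have "s i a \<in> Field \<tau>" "s i b \<in> Field \<tau>"
      using s(1)[OF i F(1)] s(1)[OF i F(2)] lt_in_Field by fast+
    \<comment> \<open>The stabilisation points of \<open>a\<close> and \<open>b\<close> are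
      unrelated, so the comparison passes through a common later endpoint \<open>y\<close>.\<close>
    then obtain y where y: "lt_in \<tau> (s i a) y" "lt_in \<tau> (s i b) y"
      using lt_in_common[OF t(1,2)] by blast
    have "guessed (W b (s i b)) i - guessed (W b y) i \<in> J"
      using upper[OF i s(1)[OF i F(2)] y(2)] I_kappa_subset_J by blast
    moreover have "guessed (W b y) i - guessed (W a y) i \<in> J"
      using lower[OF i ab tr[OF s(1)[OF i F(2)] y(2)]] I_kappa_subset_J by blast
    moreover have "guessed (W a y) i - guessed (W a (s i a)) i \<in> J"
      using s(2)[OF i F(1) y(1)] .
    ultimately show ?thesis unfolding N_def using J_Diff_trans by blast
  qed
  have "\<exists>x\<in>Field \<tau>. \<forall>y. lt_in \<tau> x y \<longrightarrow> N i x - N i y \<in> J" if "i \<in> Field \<nu>" for i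
    using desc_tower_or_stable[where A = "N i", OF t is_ideal _ _ no_desc] N_mono[OF that] guessed_Field
    unfolding N_def by blast
  then obtain x where x: "\<And>i. i \<in> Field \<nu> \<Longrightarrow> x i \<in> Field \<tau>"
    "\<And>i y. i \<in> Field \<nu> \<Longrightarrow> lt_in \<tau> (x i) y \<Longrightarrow> N i (x i) - N i y \<in> J"
    by metis
  \<comment> \<open>From \<open>a\<close> on, every limit \<open>N i\<close> is constant modulo
    \<open>J\<close>. Below, \<open>c b\<close> is an endpoint at which the gap starting at
    \<open>b\<close> has stabilised for all indices at once.\<close>
  obtain a where a: "a \<in> Field \<tau>" "\<And>i. i \<in> Field \<nu> \<Longrightarrow> lt_in \<tau> (x i) a"
    using bound[of x] x(1) by blast
  have "\<exists>y\<in>Field \<tau>. \<forall>i\<in>Field \<nu>. lt_in \<tau> (s i b) y" if "b \<in> Field \<tau>" for b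
  proof (rule bound)
    show "s i b \<in> Field \<tau>" if "i \<in> Field \<nu>" for i
      using s(1)[OF that \<open>b \<in> Field \<tau>\<close>] lt_in_Field by fast
  qed
  then obtain c where c: "\<And>b. b \<in> Field \<tau> \<Longrightarrow> c b \<in> Field \<tau>"
    "\<And>i b. b \<in> Field \<tau> \<Longrightarrow> i \<in> Field \<nu> \<Longrightarrow> lt_in \<tau> (s i b) (c b)"
    by metis
  have bc: "lt_in \<tau> b (c b)" if "b \<in> Field \<tau>" for b
  proof -
    obtain i where "i \<in> Field \<nu>" using inf_nu by fastforce
    then show ?thesis using s(1) c(2) tr that by blast
  qed

  have N_J: "N i (x i) \<in> J" if i: "i \<in> Field \<nu>" for i
  proof (rule ccontr)
    assume notJ: "N i (x i) \<notin> J"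
    have u: "|underS \<nu> j| <o \<tau>" if "j \<in> Field \<nu>" for j
      using card_of_underS[OF card_nu that] nu_t ordLess_transitive by blast
    obtain g where g: "\<And>j. j \<in> Field \<nu> \<Longrightarrow> lt_in \<tau> a (g j)"
      "\<And>j k. lt_in \<nu> j k \<Longrightarrow> lt_in \<tau> (c (g j)) (g k)"
      using increasing_selection[where c = c, OF t well_nu u c(1) a(1)] by blast
    have gF: "g j \<in> Field \<tau>" if "j \<in> Field \<nu>" for j
      using g(1)[OF that] lt_in_Field by fast
    \<comment> \<open>Each gap ends before the next starts, so the \<open>V j\<close> are almost
      disjoint. Each starts beyond \<open>a\<close> and ends at a stabilised endpoint, so its
      guessed set contains \<open>N i (x i)\<close> modulo \<open>J\<close>.\<close>
    define V where "V j = W (g j) (c (g j))" for j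
    \<comment> \<open>\<open>D\<close> collects all pairwise overlaps; beyond its bound \<rho> the
      sets \<open>V j\<close> are truly disjoint.\<close>
    define D where "D = (\<Union>j\<in>Field \<nu>. \<Union>k\<in>Field \<nu>. if lt_in \<nu> j k then V j \<inter> V k else {})"
    have "|D| \<le>o \<nu>"
      unfolding D_def
    proof (intro small_UN)
      fix j k assume jk: "j \<in> Field \<nu>" "k \<in> Field \<nu>"
      have "|V j \<inter> V k| \<le>o \<nu>" if "lt_in \<nu> j k"
        unfolding V_def using W_disj bc gF jk g(2)[OF that] by blast
      then show "|if lt_in \<nu> j k then V j \<inter> V k else {}| \<le>o \<nu>"
        by (simp add: card_of_empty1 well_nu)
    qed
    moreover have "D \<subseteq> Field r" unfolding D_def V_def using W_Field by (auto split: if_splits)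
    ultimately obtain \<rho> where \<rho>: "\<rho> \<in> Field r" "\<And>x. x \<in> D \<Longrightarrow> lt_in r x \<rho>"
      using small_bound by blast
    have "N i (x i) - guessed (V j) i \<in> J" if j: "j \<in> Field \<nu>" for j
    proof -
      have "N i (x i) - N i (g j) \<in> J" using x(2)[OF i tr[OF a(2)[OF i] g(1)[OF j]]] .
      moreover have "N i (g j) - guessed (V j) i \<in> J"
        unfolding N_def V_def
        using upper[OF i s(1)[OF i gF[OF j]] c(2)[OF gF[OF j] i]] I_kappa_subset_J by blast
      ultimately show ?thesis using J_Diff_trans by blast
    qed
    then have "(\<Union>j\<in>Field \<nu>. N i (x i) - guessed (V j) i) \<in> J" by (rule J_UN)
    then have bad: "(\<Union>j\<in>Field \<nu>. N i (x i) - guessed (V j) i) \<union> {\<delta>. (\<delta>, \<rho>) \<in> r} \<in> J"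
      using J_Un under_bounded[OF \<rho>(1)] I_kappa_subset_J by blast
    \<comment> \<open>A positive set is not covered by \<nu> many exceptional sets from
      \<open>J\<close> and a bounded set. At the resulting \<delta> the single set
      \<open>B \<delta> i\<close> is cofinal in every \<open>V j\<close>.\<close>
    obtain \<delta> where "\<delta> \<in> N i (x i)"
      "\<delta> \<notin> (\<Union>j\<in>Field \<nu>. N i (x i) - guessed (V j) i) \<union> {\<delta>. (\<delta>, \<rho>) \<in> r}"
      using notJ J_subset[OF bad, of "N i (x i)"] by blast
    then have \<delta>: "\<delta> \<in> N i (x i)" "(\<delta>, \<rho>) \<notin> r" "\<And>j. j \<in> Field \<nu> \<Longrightarrow> \<delta> \<in> guessed (V j) i"
      by blast+
    have \<delta>F: "\<delta> \<in> Field r" using \<delta>(1) guessed_Field unfolding N_def by blast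
    then have lt: "\<rho> \<in> underS r \<delta>"
      using not_le_iff_lt_in[OF well_r \<delta>F \<rho>(1)] \<delta>(2) by (simp add: lt_in_iff_underS)
    have "\<exists>z. z \<in> V j \<inter> B \<delta> i \<and> lt_in r \<rho> z" if "j \<in> Field \<nu>" for j
      using \<delta>(3)[OF that] lt unfolding guessed_def sup_eq_def by blast
    then obtain z where z: "\<And>j. j \<in> Field \<nu> \<Longrightarrow> z j \<in> V j \<inter> B \<delta> i" "\<And>j. j \<in> Field \<nu> \<Longrightarrow> lt_in r \<rho> (z j)"
      by metis
    have "z j \<noteq> z k" if jk: "lt_in \<nu> j k" for j k
    proof
      assume "z j = z k"
      moreover have F: "j \<in> Field \<nu>" "k \<in> Field \<nu>" using lt_in_Field[OF jk] by auto
      ultimately have "z j \<in> D" unfolding D_def using jk z(1)[OF F(1)] z(1)[OF F(2)] by force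
      then have "lt_in r \<rho> \<rho>" using \<rho>(2) z(2)[OF F(1)] lt_in_trans[OF well_r] by blast
      then show False by (simp add: lt_in_def)
    qed
    \<comment> \<open>A common value would be an overlap above \<rho>. So \<open>z\<close> injects
      \<nu> into \<open>B \<delta> i\<close>, contrary to \<open>B_small\<close>.\<close>
    then have "inj_on z (Field \<nu>)"
      using lt_in_total[OF well_nu] by (metis inj_onI)
    moreover have "z ` Field \<nu> \<subseteq> B \<delta> i" using z(1) by blast
    ultimately have "|Field \<nu>| \<le>o |B \<delta> i|" using card_of_ordLeq by blast
    then have "\<nu> \<le>o |B \<delta> i|"
      using card_of_Field_ordIso[OF card_nu] ordIso_symmetric ordIso_ordLeq_trans by blast
    then show False using B_small[OF \<delta>F i] not_ordLess_ordLeq by blast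
  qed

  \<comment> \<open>The one gap from \<open>a\<close> to \<open>c a\<close> refutes guessing: each
    of its guessed sets lies in \<open>N i a\<close>, hence in \<open>N i (x i)\<close>, modulo
    \<open>J\<close>.\<close>
  have "guessed (W a (c a)) i \<in> J" if i: "i \<in> Field \<nu>" for i
  proof -
    have "guessed (W a (c a)) i - N i a \<in> J"
      unfolding N_def using s(2)[OF i a(1) c(2)[OF a(1) i]] .
    then have "guessed (W a (c a)) i - N i (x i) \<in> J"
      using J_Diff_trans N_mono[OF i a(2)[OF i]] by blast
    then show ?thesis using J_subset[OF J_Un[OF _ N_J[OF i]]] by blast
  qed
  then have "(\<Union>i\<in>Field \<nu>. guessed (W a (c a)) i) \<in> J" by (rule J_UN)
  then show False
    using B_guess[OF W_Field W_card[OF bc[OF a(1)]]] unfolding guessed_def by blast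
qed

section \<open>Gaps between the functions of an increasing sequence\<close>

lemma tower_of_increasing:
  fixes \<tau> :: "'c rel"
  assumes t: "Card_order \<tau>" "\<not> finite (Field \<tau>)" "regularCard \<tau>" and nu_t: "\<nu> <o \<tau>"
    and f: "incr_seq r \<tau> f"
  shows "(\<exists>A. asc_tower r J (I_kappa r) \<tau> A) \<or> (\<exists>A. desc_tower r J J \<tau> A)"
proof -
  have "|Field r \<times> Field r| =o |Field r|" using card_of_Times_same_infinite inf_r by blast
  then obtain h where h: "bij_betw h (Field r) (Field r \<times> Field r)"
    using card_of_ordIso ordIso_symmetric by blast
  define p q where "p x = fst (h x)" and "q x = snd (h x)" for x
  have pqF: "p x \<in> Field r" "q x \<in> Field r" if "x \<in> Field r" for x
    using bij_betwE[OF h] that by (auto simp: p_def q_def mem_Times_iff)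
  \<comment> \<open>Codes of the points between the graphs of \<open>f a\<close> and
    \<open>f b\<close>. The set \<open>E a b\<close> below is where the order of the two functions
    fails.\<close>
  define W where "W a b = {x\<in>Field r. (f a (p x), q x) \<in> r \<and> lt_in r (q x) (f b (p x))}" for a b
  define E where "E a b = {\<xi>\<in>Field r. (f b \<xi>, f a \<xi>) \<in> r}" for a b
  have E_small: "|E a b| \<le>o \<nu>" if "lt_in \<tau> a b" for a b
    using f that less_r_iff unfolding incr_seq_def lt_star_def E_def by blast
  have fF: "f a \<xi> \<in> Field r" if "a \<in> Field \<tau>" "\<xi> \<in> Field r" for a \<xi>
    using f that unfolding incr_seq_def fun_kk_def by blast
  have f_lt: "lt_in r (f a \<xi>) (f b \<xi>)" if "lt_in \<tau> a b" "\<xi> \<in> Field r" "\<xi> \<notin> E a b" for a b \<xi>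
    using that lt_in_Field[OF that(1)] fF not_le_iff_lt_in[OF well_r] unfolding E_def by blast
  \<comment> \<open>Over at most \<nu> many bad columns, each of height below \<kappa>, there are at
    most \<nu> many codes. Every error between gaps is of this form.\<close>
  have small: "|{x\<in>Field r. p x \<in> E a b \<and> lt_in r (q x) (f d (p x))}| \<le>o \<nu>" (is "|?S| \<le>o \<nu>")
    if ab: "lt_in \<tau> a b" for a b d
  proof -
    let ?T = "SIGMA \<xi>:E a b. underS r (f d \<xi>)"
    have "|underS r y| \<le>o \<nu>" for y
    proof (cases "y \<in> Field r")
      case True
      then show ?thesis using card_of_underS[OF card_r] less_r_iff by blast
    next
      case False
      then have "underS r y = {}" by (auto simp: underS_def Field_def)
      then show ?thesis by (simp add: card_of_empty1 well_nu)
    qed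
    then have "|?T| \<le>o \<nu>"
      by (intro card_of_Sigma_ordLeq_infinite_Field[OF inf_nu card_nu E_small[OF ab]] ballI)
    moreover have "h ` ?S \<subseteq> ?T"
      by (auto simp: p_def q_def lt_in_iff_underS mem_Sigma_iff split_beta) (metis fst_conv snd_conv)+
    moreover have "inj_on h ?S"
      by (rule inj_on_subset[OF bij_betw_imp_inj_on[OF h]]) blast
    ultimately have "|?S| \<le>o |?T|" 
      by (intro card_of_ordLeq[THEN iffD1] exI[of _ h] conjI)
    then show ?thesis using \<open>|?T| \<le>o \<nu>\<close> ordLeq_transitive by blast
  qed
  show ?thesis
  proof (rule tower_of_gaps[OF t nu_t, of W])
    show "W a b \<subseteq> Field r" for a b by (auto simp: W_def)
  next
    fix a b assume ab: "lt_in \<tau> a b"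
    then have F: "a \<in> Field \<tau>" "b \<in> Field \<tau>" using lt_in_Field by fast+
    \<comment> \<open>Over a good column the lowest point \<open>f a \<xi>\<close> lies in the gap.
      So the gap projects onto all but \<nu> many columns and has size \<kappa>.\<close>
    have "Field r - E a b \<subseteq> p ` W a b"
    proof
      fix \<xi> assume \<xi>: "\<xi> \<in> Field r - E a b"
      then have "(\<xi>, f a \<xi>) \<in> h ` Field r" using h fF F by (auto simp: bij_betw_def)
      then obtain x where x: "x \<in> Field r" "h x = (\<xi>, f a \<xi>)" by auto
      then have "x \<in> W a b"
        using f_lt[OF ab] \<xi> fF[OF F(1)] Well_order_refl[OF well_r] by (simp add: W_def p_def q_def)
      then show "\<xi> \<in> p ` W a b" using x by (force simp: p_def)
    qed
    from ordLeq_transitive[OF card_of_mono1[OF this] card_of_image]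
    have le: "|Field r - E a b| \<le>o |W a b|" .
    have "\<not> |W a b| \<le>o \<nu>"
    proof
      assume "|W a b| \<le>o \<nu>"
      then have "|(Field r - E a b) \<union> E a b| \<le>o \<nu>"
        by (rule small_Un[OF ordLeq_transitive[OF le] E_small[OF ab]])
      moreover have "(Field r - E a b) \<union> E a b = Field r" by (auto simp: E_def)
      ultimately have "|Field r| <o r" by (simp add: less_r_iff)
      then show False using card_of_Field_ordIso[OF card_r] not_ordLess_ordIso by blast
    qed
    then have "\<not> |W a b| <o r" using less_r_iff by blast
    moreover have "|W a b| \<le>o r"
      using card_of_mono1[of "W a b" "Field r"] card_of_Field_ordIso[OF card_r] ordLeq_ordIso_trans
      unfolding W_def by blast
    ultimately show "|W a b| =o r" using ordLeq_iff_ordLess_or_ordIso by blast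
  next
    fix a b c assume ab: "lt_in \<tau> a b" and bc: "lt_in \<tau> b c"
    have "W a b - W a c \<subseteq> {x\<in>Field r. p x \<in> E b c \<and> lt_in r (q x) (f b (p x))}"
      using f_lt[OF bc] pqF lt_in_trans[OF well_r] unfolding W_def by blast
    then show "|W a b - W a c| \<le>o \<nu>" using small[OF bc] small_subset by blast
    have "W b c - W a c \<subseteq> {x\<in>Field r. p x \<in> E a b \<and> lt_in r (q x) (f c (p x))}"
      using f_lt[OF ab] pqF lt_le_in_trans[OF well_r] unfolding W_def lt_in_def by blast
    then show "|W b c - W a c| \<le>o \<nu>" using small[OF ab] small_subset by blast
    fix d assume "lt_in \<tau> c d"
    have "\<not> lt_in r y z" if "(z, y) \<in> r" for y z
      using le_lt_in_trans[OF well_r that, of z] by (auto simp: lt_in_def)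
    \<comment> \<open>A common point has height at least \<open>f c \<xi>\<close> and below
      \<open>f b \<xi>\<close>, so its column is bad for \<open>b\<close> and
      \<open>c\<close>.\<close>
    then have "W a b \<inter> W c d \<subseteq> {x\<in>Field r. p x \<in> E b c \<and> lt_in r (q x) (f b (p x))}"
      using f_lt[OF bc] pqF lt_in_trans[OF well_r] unfolding W_def by blast
    then show "|W a b \<inter> W c d| \<le>o \<nu>" using small[OF bc] small_subset by blast
  qed
qed

end

section \<open>From the club principle to guessing sets indexed by \<nu>\<close>

lemma clubsuit_infinite:
  assumes r: "Card_order r" and J: "is_ideal r J" and club: "clubsuit_cof_minus r J"
  shows "\<not> finite (Field r)"
proof
  assume fin: "finite (Field r)"
  have wo: "Well_order r" using r card_order_on_well_order_on by blast
  obtain B where "{\<delta>\<in>Field r. \<exists>i\<in>underS r \<delta>. sup_eq r (Field r \<inter> B \<delta> i) \<delta>} \<in> Jplus r J"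
    using club card_of_Field_ordIso[OF r] unfolding clubsuit_cof_minus_def by blast
  moreover have "{} \<in> J" using J unfolding is_ideal_def by blast
  ultimately have "{\<delta>\<in>Field r. \<exists>i\<in>underS r \<delta>. sup_eq r (Field r \<inter> B \<delta> i) \<delta>} \<noteq> {}"
    unfolding Jplus_def by (metis DiffD2)
  then obtain \<delta> i where i: "i \<in> underS r \<delta>" and sup: "sup_eq r (Field r \<inter> B \<delta> i) \<delta>" by blast
  have no_max: "\<exists>y\<in>underS r \<delta>. lt_in r x y" if "x \<in> underS r \<delta>" for x
    using sup that unfolding sup_eq_def by blast
  \<comment> \<open>In a finite order the nonempty segment below \<delta> would have a largest
    element, which contradicts \<open>no_max\<close>.\<close>
  have "wf (r\<inverse> - Id)"
  proof (rule finite_acyclic_wf)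
    have "r \<subseteq> Field r \<times> Field r" by (auto simp: Field_def)
    then show "finite (r\<inverse> - Id)" using fin finite_subset by fastforce
    have "acyclic (r - Id)"
      using wo by (intro wf_acyclic) (simp add: well_order_on_def)
    moreover have "(r - Id)\<inverse> = r\<inverse> - Id" by auto
    ultimately show "acyclic (r\<inverse> - Id)" by (metis acyclic_converse)
  qed
  then obtain m where "m \<in> underS r \<delta>" "\<And>y. (y, m) \<in> r\<inverse> - Id \<Longrightarrow> y \<notin> underS r \<delta>"
    using wfE_min[OF _ i] by blast
  then show False using no_max unfolding lt_in_def by blast
qed

lemma clubsuit_cof_guessing:
  assumes r: "Card_order r" and nu: "Card_order \<nu>" and succ: "r =o cardSuc \<nu>"
    and J: "complete_ideal r J" and club: "clubsuit_cof_minus r J"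
  shows "\<exists>B. cof_guessing r \<nu> J B"
proof -
  have idl: "is_ideal r J" using J by (simp add: complete_ideal_def)
  have inf_nu: "\<not> finite (Field \<nu>)"
    using clubsuit_infinite[OF r idl club] card_of_ordIso_finite[OF card_of_cong[OF succ]]
      cardSuc_finite[OF nu] by blast
  obtain B0 where "\<forall>\<delta>\<in>Field r. \<forall>i\<in>underS r \<delta>. B0 \<delta> i \<subseteq> underS r \<delta> \<and> |B0 \<delta> i| <o |underS r \<delta>|"
    and guess: "\<forall>W. W \<subseteq> Field r \<and> |W| =o r \<longrightarrow>
      {\<delta>\<in>Field r. \<exists>i\<in>underS r \<delta>. sup_eq r (W \<inter> B0 \<delta> i) \<delta>} \<in> Jplus r J"
    using club unfolding clubsuit_cof_minus_def by (elim exE conjE) (rule that)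
  then have B0: "B0 \<delta> i \<subseteq> underS r \<delta> \<and> |B0 \<delta> i| <o |underS r \<delta>|"
    if "i \<in> underS r \<delta>" "\<delta> \<in> Field r" for \<delta> i
    using that by simp
  have under_small: "|underS r \<delta>| \<le>o \<nu>" if "\<delta> \<in> Field r" for \<delta>
    using ordLess_ordIso_trans[OF card_of_underS[OF r that] succ]
      cardSuc_ordLeq_ordLess[OF nu card_of_Card_order] by blast
  have "\<exists>e. underS r \<delta> \<subseteq> e ` Field \<nu>" if "\<delta> \<in> Field r" for \<delta>
  proof (cases "underS r \<delta> = {}")
    case False
    have "|underS r \<delta>| \<le>o |Field \<nu>|"
      using under_small[OF that] card_of_Field_ordIso[OF nu] ordIso_symmetric ordLeq_ordIso_trans
      by blast
    then show ?thesis using card_of_ordLeq2[OF False, of "Field \<nu>"] by blast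
  qed simp
  then obtain e where e: "\<And>\<delta>. \<delta> \<in> Field r \<Longrightarrow> underS r \<delta> \<subseteq> e \<delta> ` Field \<nu>" by metis
  \<comment> \<open>The indices below \<delta> are listed by \<nu> via \<open>e \<delta>\<close>.
    Values outside \<delta> get the empty set, whose size is below the infinite \<nu>.\<close>
  define B where "B \<delta> i = (if e \<delta> i \<in> underS r \<delta> then B0 \<delta> (e \<delta> i) else {})" for \<delta> i
  have "cof_guessing r \<nu> J B"
  proof
    fix \<delta> i assume \<delta>: "\<delta> \<in> Field r" and i: "i \<in> Field \<nu>"
    have "|{} :: 'a set| <o \<nu>"
      using nu card_order_on_well_order_on
      by (intro finite_ordLess_infinite[OF card_of_Well_order _ _ inf_nu]) (auto simp: Field_card_of)
    moreover have "|B0 \<delta> (e \<delta> i)| <o \<nu>" if "e \<delta> i \<in> underS r \<delta>"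
      using ordLess_ordLeq_trans[OF _ under_small[OF \<delta>]] B0[OF that \<delta>] by blast
    ultimately show "|B \<delta> i| <o \<nu>" by (simp add: B_def)
    show "B \<delta> i \<subseteq> underS r \<delta>" using B0[OF _ \<delta>] unfolding B_def by auto
  next
    fix W assume W: "W \<subseteq> Field r" "|W| =o r"
    have "{\<delta>\<in>Field r. \<exists>i\<in>underS r \<delta>. sup_eq r (W \<inter> B0 \<delta> i) \<delta>}
        \<subseteq> (\<Union>i\<in>Field \<nu>. {\<delta>\<in>Field r. sup_eq r (W \<inter> B \<delta> i) \<delta>})" (is "?S \<subseteq> ?T")
    proof
      fix \<delta> assume "\<delta> \<in> ?S"
      then obtain i where i: "\<delta> \<in> Field r" "i \<in> underS r \<delta>" "sup_eq r (W \<inter> B0 \<delta> i) \<delta>" by blast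
      then obtain j where "j \<in> Field \<nu>" "e \<delta> j = i" using e by blast
      then show "\<delta> \<in> ?T" using i unfolding B_def by auto
    qed
    moreover have "?S \<notin> J" using guess W by (simp add: Jplus_def)
    moreover have "X \<in> J" if "Y \<in> J" "X \<subseteq> Y" for X Y
      using idl that unfolding is_ideal_def by blast
    ultimately show "?T \<notin> J" by blast
  qed (fact r nu succ inf_nu J)+
  then show ?thesis by blast
qed

theorem theorem3p9:
  fixes r :: "'a rel" and \<nu> :: "'b rel" and \<tau> :: "'c rel" and J :: "'a set set"
  assumes "Card_order r"
    and "Card_order \<nu>" and "(r, cardSuc \<nu>) \<in> ordIso"
    and "complete_ideal r J"
    and "clubsuit_cof_minus r J"
    and "Card_order \<tau>" and "\<not> finite (Field \<tau>)" and "regularCard \<tau>"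
    and "below_depth r \<tau>"
  shows "(\<exists>A. asc_tower r J (I_kappa r) \<tau> A) \<or> (\<exists>A. desc_tower r J J \<tau> A)"
proof -
  obtain B where "cof_guessing r \<nu> J B" using clubsuit_cof_guessing[OF assms(1-5)] by blast
  then interpret cof_guessing r \<nu> J B .
  have wo: "Well_order \<tau>" using assms(6) card_order_on_well_order_on by blast
  show ?thesis
  proof (cases "\<nu> <o \<tau>")
    case True
    have "\<tau> \<le>o \<tau>" using wo ordLeq_reflexive by blast
    then obtain f where "incr_seq r \<tau> f" using assms(9) wo unfolding below_depth_def by blast
    then show ?thesis using tower_of_increasing[OF assms(6-8) True] by blast
  next
    case False
    have "\<tau> \<le>o r"
      using False wo well_nu nu_less_r not_ordLess_iff_ordLeq ordLess_imp_ordLeq ordLeq_transitive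
      by blast
    then obtain e where e: "embed \<tau> r e" unfolding ordLeq_def by blast
    \<comment> \<open>For constants in strict order the exceptional set is empty. The length
      \<kappa> is regular and above \<nu>, as \<open>tower_of_increasing\<close> requires.\<close>
    have "incr_seq r r (\<lambda>a \<xi>. a)"
      unfolding incr_seq_def fun_kk_def lt_star_def
    proof (intro conjI ballI allI impI)
      fix a b assume ab: "lt_in r a b"
      have "(b, a) \<notin> r" using not_le_iff_lt_in[OF well_r] ab lt_in_Field[OF ab] by blast
      then show "|{\<alpha>\<in>Field r. (b, a) \<in> r}| <o r"
        by (simp add: less_r_iff card_of_empty1 well_nu)
    qed
    then have "(\<exists>A. asc_tower r J (I_kappa r) r A) \<or> (\<exists>A. desc_tower r J J r A)"
      using tower_of_increasing[OF card_r inf_r regular_r nu_less_r] by blast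
    then show ?thesis using tower_restrict[OF wo e] by blast
  qed
qed

end
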